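(* Let $P(z)$ be a polynomial of degree $n$ with complex coefficients which does not vanish in $|z|<1$, and let $a\in\mathbb{C}$ with $|a|\le 1$. Then for all real or complex numbers $\alpha,\beta$ with $|\alpha|\le 1$, $|\beta|\le 1$, every real $R\ge 1$, and every $z\in\mathbb{C}$ with $|z|\ge 1$, $$\left|\tilde{\mathbb{S}}_a[P](Rz)-\alpha\,\tilde{\mathbb{S}}_a[P](z)+\beta\left\{\left(\tfrac{R+1}{2}\right)^n-|\alpha|\right\}\tilde{\mathbb{S}}_a[P](z)\right|$$ $$\le\frac12\left[\left|R^n-\alpha+\beta\left\{\left(\tfrac{R+1}{2}\right)^n-|\alpha|\right\}\right|\bigl|\tilde{\mathbb{S}}_a[z^n]\bigr|+\left|1-\alpha+\beta\left\{\left(\tfrac{R+1}{2}\right)^n-|\alpha|\right\}\right|n|a|\right]\max_{|\zeta|=1}|P(\zeta)|.$$ Equality in this inequality holds for $P(z)=z^n+1$.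
   Context: For $a\in\mathbb{C}$ with $|a|\le 1$ and a polynomial $P$ of degree $n$, the modified Smirnov operator is $\tilde{\mathbb{S}}_a[P](z)=(1+az)P'(z)-naP(z)$. The symbol $\tilde{\mathbb{S}}_a[P](Rz)$ denotes the operator applied to the polynomial $z\mapsto P(Rz)$ and evaluated at $z$, i.e. $\tilde{\mathbb{S}}_a[P](Rz)=(1+az)\,R\,P'(Rz)-na\,P(Rz)$. The symbol $\tilde{\mathbb{S}}_a[z^n]$ denotes the operator applied to the monomial $z^n$, evaluated at $z$, i.e. $\tilde{\mathbb{S}}_a[z^n]=nz^{n-1}$.
   Formalization: Equality for P(z)=z^n+1 fails for general a, z (n=1, α=β=0, a=1: R-1 < R+1); it is stated as attainment: for every z and modulus of a some such a, and for n≥2 for every a and radius |z| some such z, gives equality. *)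

theory Defs
  imports "HOL-Analysis.Analysis" "HOL-Computational_Algebra.Polynomial"
begin

text \<open>The number \<open>n\<close> in \<open>(1 + a z) P'(z) - n a P(z)\<close> is the degree of \<open>P\<close>.\<close>

definition mod_smirnov :: "complex \<Rightarrow> complex poly \<Rightarrow> complex \<Rightarrow> complex" where
  "mod_smirnov a P z =
     (1 + a * z) * poly (pderiv P) z - of_nat (degree P) * a * poly P z"

definition dilate :: "real \<Rightarrow> complex poly \<Rightarrow> complex poly" where
  "dilate R P = pcompose P [:0, complex_of_real R:]"

text \<open>The supremum is a maximum; see \<open>max_unit_circle_is_max\<close>.\<close>

definition max_unit_circle :: "complex poly \<Rightarrow> real" where
  "max_unit_circle P = (SUP \<zeta>\<in>sphere 0 1. cmod (poly P \<zeta>))"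

lemma max_unit_circle_is_max:
  "\<exists>\<zeta>. cmod \<zeta> = 1 \<and> cmod (poly P \<zeta>) = max_unit_circle P
       \<and> (\<forall>\<xi>. cmod \<xi> = 1 \<longrightarrow> cmod (poly P \<xi>) \<le> cmod (poly P \<zeta>))"
proof -
  have ne: "sphere (0::complex) 1 \<noteq> {}" by simp
  have cont: "continuous_on (sphere 0 1) (\<lambda>\<zeta>. cmod (poly P \<zeta>))"
    by (intro continuous_intros)
  obtain \<zeta> where z: "\<zeta> \<in> sphere 0 1"
    and m: "\<forall>\<xi>\<in>sphere 0 1. cmod (poly P \<xi>) \<le> cmod (poly P \<zeta>)"
    using continuous_attains_sup[OF compact_sphere ne cont] by blast
  have "max_unit_circle P = cmod (poly P \<zeta>)"
    unfolding max_unit_circle_def using z m by (intro cSup_eq_maximum) auto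
  then show ?thesis using z m by auto
qed

text \<open>The operator is not linear across degrees, so \<open>\<S>[P](Rz)\<close> is the operator applied
  to the polynomial \<open>z \<mapsto> P(Rz)\<close>, which has the degree of \<open>P\<close> when \<open>R \<noteq> 0\<close>.\<close>

lemma mod_smirnov_dilate:
  assumes "R \<noteq> 0"
  shows "mod_smirnov a (dilate R P) z =
    (1 + a * z) * of_real R * poly (pderiv P) (of_real R * z)
      - of_nat (degree P) * a * poly P (of_real R * z)"
  using assms
  by (simp add: mod_smirnov_def dilate_def pderiv_pcompose poly_pcompose degree_pcompose
      pderiv_pCons mult.commute mult.left_commute)

definition beta_factor :: "nat \<Rightarrow> complex \<Rightarrow> real \<Rightarrow> real" where
  "beta_factor n \<alpha> R = ((R + 1) / 2) ^ n - cmod \<alpha>"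

definition smirnov_lhs ::
  "complex \<Rightarrow> complex \<Rightarrow> complex \<Rightarrow> real \<Rightarrow> complex poly \<Rightarrow> complex \<Rightarrow> real" where
  "smirnov_lhs a \<alpha> \<beta> R P z =
     cmod (mod_smirnov a (dilate R P) z
           - \<alpha> * mod_smirnov a P z
           + \<beta> * of_real (beta_factor (degree P) \<alpha> R) * mod_smirnov a P z)"

definition smirnov_rhs ::
  "complex \<Rightarrow> complex \<Rightarrow> complex \<Rightarrow> real \<Rightarrow> complex poly \<Rightarrow> complex \<Rightarrow> real" where
  "smirnov_rhs a \<alpha> \<beta> R P z =
     (let n = degree P; B = \<beta> * of_real (beta_factor n \<alpha> R) in
      1 / 2 *
      (cmod (of_real R ^ n - \<alpha> + B) * cmod (mod_smirnov a (monom 1 n) z)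
       + cmod (1 - \<alpha> + B) * real n * cmod a)
      * max_unit_circle P)"

end

theory Submission
  imports Defs "HOL-Computational_Algebra.Fundamental_Theorem_Algebra"
    "HOL-Complex_Analysis.Conformal_Mappings"
begin

text \<open>Write \<open>L p\<close> for the operator applied to \<open>p (R z) + c p z\<close>, where
  \<open>cmod c \<le> ((R + 1) / 2)^n\<close>. If \<open>p\<close> has degree \<open>n\<close> and all zeros in the closed disc, so has
  that combination, because \<open>cmod (p (R z)) > ((R + 1) / 2)^n * cmod (p z)\<close> outside the disc;
  by Laguerre's theorem \<open>L p\<close> then has no zeros outside the disc either. Hence \<open>L\<close> preserves
  inequalities \<open>cmod h \<le> cmod g\<close> outside the disc: a value \<open>L h z = k * L g z\<close> with
  \<open>cmod k > 1\<close> would make \<open>z\<close> a zero of \<open>L (h - k g)\<close>. Comparing \<open>P\<close> with its reciprocal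
  polynomial \<open>Q\<close> gives \<open>cmod (L P) \<le> cmod (L Q)\<close>, and the same comparison for \<open>P\<close> translated by
  a constant of modulus \<open>max \<bar>P\<bar>\<close> bounds \<open>cmod (L P) + cmod (L Q)\<close>.\<close>

section \<open>Splitting off linear factors\<close>

lemma degree_linear_factor_mult:
  fixes q :: "'a :: idom poly"
  shows "q \<noteq> 0 \<Longrightarrow> degree ([:-r, 1:] * q) = Suc (degree q)"
  by (simp add: degree_mult_eq del: mult_pCons_left)

text \<open>Over an algebraically closed field every nonconstant polynomial has a root to split off.
  Zero-location estimates thus reduce to one estimate per linear factor.\<close>

lemma poly_linear_factor_induct [consumes 1, case_names const mult]:
  fixes p :: "'a :: alg_closed_field poly"
  assumes "p \<noteq> 0"
    and const: "\<And>c. c \<noteq> 0 \<Longrightarrow> Q [:c:]"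
    and mult: "\<And>r q. q \<noteq> 0 \<Longrightarrow> Q q \<Longrightarrow> Q ([:-r, 1:] * q)"
  shows "Q p"
  using \<open>p \<noteq> 0\<close>
proof (induction "degree p" arbitrary: p)
  case 0
  then obtain c where "p = [:c:]" by (metis degree_eq_zeroE)
  with 0 const show ?case by simp
next
  case (Suc d)
  then obtain r where "poly p r = 0"
    using alg_closed_imp_poly_has_root[of p] by auto
  then obtain q where q: "p = [:-r, 1:] * q"
    by (auto simp: poly_eq_0_iff_dvd)
  with Suc.prems have "q \<noteq> 0" by auto
  with Suc.hyps q have "degree q = d" by (simp add: degree_linear_factor_mult del: mult_pCons_left)
  with Suc.hyps \<open>q \<noteq> 0\<close> have "Q q" by blast
  with mult \<open>q \<noteq> 0\<close> q show ?case by simp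
qed

lemma poly_linear_factor_mult:
  fixes q :: "'a :: comm_ring_1 poly"
  shows "poly ([:-r, 1:] * q) z = (z - r) * poly q z"
  by (simp add: algebra_simps)

section \<open>Growth under dilation\<close>

lemma complex_norm_diff_power2:
  "(cmod (z - w))\<^sup>2 = (cmod z)\<^sup>2 - 2 * Re (z * cnj w) + (cmod w)\<^sup>2"
  unfolding cmod_power2 by (simp add: power2_eq_square algebra_simps)

lemma abs_Re_mult_cnj_le: "\<bar>Re (z * cnj w)\<bar> \<le> cmod z * cmod w"
  using abs_Re_le_cmod[of "z * cnj w"] by (simp add: norm_mult)

text \<open>The difference of squares increases with \<open>Re (z * cnj r)\<close>, so the worst
  case is \<open>r\<close> pointing opposite to \<open>z\<close>, where it factors with
  \<open>t - s\<close>. The constant is the ratio at \<open>r = -z\<close> on the unit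
  circle.\<close>

lemma norm_diff_expand_gt:
  assumes "cmod r \<le> 1" "1 < cmod z" "1 < R"
  shows "(R + 1) / 2 * cmod (z - r) < cmod (of_real R * z - r)"
proof -
  define t s c where "t = cmod z" and "s = cmod r" and "c = Re (z * cnj r)"
  have c: "- (t * s) \<le> c"
    using abs_Re_mult_cnj_le[of z r] by (simp add: t_def s_def c_def)
  have st: "0 \<le> s" "s < t" using assms by (auto simp: s_def t_def)
  have 1: "(cmod (z - r))\<^sup>2 = t\<^sup>2 - 2 * c + s\<^sup>2"
    by (simp add: complex_norm_diff_power2 t_def s_def c_def)
  have 2: "(cmod (of_real R * z - r))\<^sup>2 = R\<^sup>2 * t\<^sup>2 - 2 * R * c + s\<^sup>2"
    by (simp add: complex_norm_diff_power2 t_def s_def c_def norm_mult power_mult_distrib algebra_simps)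
  have "0 < (R - 1) * ((t - s) * ((3 * R + 1) * t + (R + 3) * s))"
    using assms st by (intro mult_pos_pos add_pos_nonneg) auto
  also have "\<dots> = (R - 1) * ((3 * R + 1) * t\<^sup>2 - (R + 3) * s\<^sup>2 + 2 * (R - 1) * (- (t * s)))"
    by (simp add: algebra_simps power2_eq_square)
  also have "\<dots> \<le> (R - 1) * ((3 * R + 1) * t\<^sup>2 - (R + 3) * s\<^sup>2 + 2 * (R - 1) * c)"
    using assms by (intro mult_left_mono add_left_mono c) auto
  also have "\<dots> = 4 * ((cmod (of_real R * z - r))\<^sup>2 - ((R + 1) / 2 * cmod (z - r))\<^sup>2)"
    unfolding power_mult_distrib 1 2 by (simp add: power2_eq_square field_simps)
  finally have "((R + 1) / 2 * cmod (z - r))\<^sup>2 < (cmod (of_real R * z - r))\<^sup>2" by simp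
  then show ?thesis by (rule power2_less_imp_less) simp
qed

lemma poly_norm_expand_gt:
  fixes p :: "complex poly"
  assumes "p \<noteq> 0" "\<And>w. cmod w > 1 \<Longrightarrow> poly p w \<noteq> 0" "1 < cmod z" "1 < R" "degree p > 0"
  shows "((R + 1) / 2) ^ degree p * cmod (poly p z) < cmod (poly p (of_real R * z))"
proof -
  \<comment> \<open>Constants give only equality, so the induction carries the weak inequality; one
    linear factor makes it strict.\<close>
  have "((R + 1) / 2) ^ degree p * cmod (poly p z) \<le> cmod (poly p (of_real R * z)) \<and>
    (degree p > 0 \<longrightarrow> ((R + 1) / 2) ^ degree p * cmod (poly p z) < cmod (poly p (of_real R * z)))"
    using assms(1,2)
  proof (induction p rule: poly_linear_factor_induct)
    case (const c)
    then show ?case by simp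
  next
    case (mult r q)
    have r: "cmod r \<le> 1" using mult.prems[of r] by (force simp del: mult_pCons_left)
    have q0: "poly q w \<noteq> 0" if "cmod w > 1" for w
      using mult.prems[OF that] by (auto simp del: mult_pCons_left)
    have IH: "((R + 1) / 2) ^ degree q * cmod (poly q z) \<le> cmod (poly q (of_real R * z))"
      using mult.IH q0 by blast
    have pos: "0 < ((R + 1) / 2) ^ degree q * cmod (poly q z)"
      using q0[of z] assms by simp
    have "((R + 1) / 2 * cmod (z - r)) * (((R + 1) / 2) ^ degree q * cmod (poly q z))
        < cmod (of_real R * z - r) * cmod (poly q (of_real R * z))"
      using norm_diff_expand_gt[OF r assms(3,4)] IH pos
      by (intro mult_less_le_imp_less) (use assms in auto)
    then show ?case
      unfolding degree_linear_factor_mult[OF mult.hyps] poly_linear_factor_mult norm_mult power_Suc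
      by (simp add: mult_ac)
  qed
  with assms(5) show ?thesis by blast
qed

section \<open>Laguerre's theorem\<close>

text \<open>The identity behind Blaschke factors. Outside the disc, the sign depends on whether
  \<open>r\<close> has modulus at most or at least 1; both cases are needed.\<close>

lemma norm_reflection_identity:
  "(cmod (z - r))\<^sup>2 - (cmod (1 - cnj z * r))\<^sup>2 = (1 - (cmod r)\<^sup>2) * ((cmod z)\<^sup>2 - 1)"
  unfolding cmod_power2 by (simp add: power2_eq_square algebra_simps)

text \<open>Each quotient \<open>1 / (z - r)\<close> with \<open>cmod r \<le> 1\<close> lies in the disc with centre
  \<open>cnj z / (t\<^sup>2 - 1)\<close> and radius \<open>1 / (t\<^sup>2 - 1)\<close>, where \<open>t = cmod z\<close>; the logarithmic
  derivative is the sum of these quotients.\<close>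

lemma log_deriv_disc:
  fixes p :: "complex poly"
  assumes "p \<noteq> 0" "\<And>w. cmod w > 1 \<Longrightarrow> poly p w \<noteq> 0" "1 < cmod z"
  shows "cmod (((cmod z)\<^sup>2 - 1) * poly (pderiv p) z - degree p * cnj z * poly p z)
    \<le> degree p * cmod (poly p z)"
  using assms(1,2)
proof (induction p rule: poly_linear_factor_induct)
  case (const c)
  then show ?case by (simp add: pderiv_pCons)
next
  case (mult r q)
  define k :: complex where "k = (cmod z)\<^sup>2 - 1"
  have r: "cmod r \<le> 1" using mult.prems[of r] by (force simp del: mult_pCons_left)
  have q0: "poly q w \<noteq> 0" if "cmod w > 1" for w
    using mult.prems[OF that] by (auto simp del: mult_pCons_left)
  have IH: "cmod (k * poly (pderiv q) z - degree q * cnj z * poly q z)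
      \<le> degree q * cmod (poly q z)"
    using mult.IH q0 by (simp add: k_def)
  have "(cmod r)\<^sup>2 \<le> 1" "1 \<le> (cmod z)\<^sup>2"
    using r assms by (auto simp: power_le_one)
  then have "0 \<le> (1 - (cmod r)\<^sup>2) * ((cmod z)\<^sup>2 - 1)" by simp
  with norm_reflection_identity[of z r] have "(cmod (1 - cnj z * r))\<^sup>2 \<le> (cmod (z - r))\<^sup>2"
    by linarith
  then have "cmod (1 - cnj z * r) \<le> cmod (z - r)"
    by (rule power2_le_imp_le) simp
  \<comment> \<open>This is the claimed bound for the single factor \<open>z - r\<close>, cleared of
    its denominator.\<close>
  moreover have "k - cnj z * (z - r) = - (1 - cnj z * r)"
    using complex_norm_square[of z] by (simp add: k_def algebra_simps)
  ultimately have lin: "cmod (k - cnj z * (z - r)) \<le> cmod (z - r)"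
    by (metis norm_minus_cancel)
  have "k * poly (pderiv ([:-r, 1:] * q)) z
        - of_nat (degree ([:-r, 1:] * q)) * cnj z * poly ([:-r, 1:] * q) z
      = (z - r) * (k * poly (pderiv q) z - degree q * cnj z * poly q z)
        + poly q z * (k - cnj z * (z - r))"
    unfolding degree_linear_factor_mult[OF mult.hyps] pderiv_mult
    by (simp add: pderiv_pCons algebra_simps)
  also have "cmod \<dots> \<le> cmod (z - r) * (degree q * cmod (poly q z)) + cmod (poly q z) * cmod (z - r)"
    by (intro norm_triangle_le add_mono) (auto simp: norm_mult intro!: mult_left_mono IH lin)
  also have "\<dots> = degree ([:-r, 1:] * q) * cmod (poly ([:-r, 1:] * q) z)"
    unfolding degree_linear_factor_mult[OF mult.hyps] poly_linear_factor_mult norm_mult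
    by (simp add: algebra_simps)
  finally show ?case by (simp add: k_def del: mult_pCons_left)
qed

text \<open>Squaring the disc inclusion \<open>log_deriv_disc\<close> leaves a common factor
  \<open>t - 1 > 0\<close>; dividing it out gives the claim.\<close>

lemma norm_polar_le_norm_deriv:
  fixes p :: "complex poly"
  assumes "p \<noteq> 0" "\<And>w. cmod w > 1 \<Longrightarrow> poly p w \<noteq> 0" "1 < cmod z"
  shows "cmod (z * poly (pderiv p) z - degree p * poly p z) \<le> cmod (poly (pderiv p) z)"
proof (rule power2_le_imp_le)
  define x y n t where "x = poly (pderiv p) z" and "y = poly p z" and "n = real (degree p)"
    and "t = (cmod z)\<^sup>2"
  define c where "c = Re (z * x * cnj y)"
  have t: "t > 1" using assms(3) by (simp add: t_def)
  have "cmod (of_real (t - 1) * x - of_real n * cnj z * y) \<le> n * cmod y"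
    using log_deriv_disc[OF assms] by (simp add: x_def y_def n_def t_def)
  then have "(cmod (of_real (t - 1) * x - of_real n * cnj z * y))\<^sup>2 \<le> (n * cmod y)\<^sup>2"
    by (rule power_mono) simp
  moreover have "(cmod (of_real (t - 1) * x - of_real n * cnj z * y))\<^sup>2
      = (t - 1)\<^sup>2 * (cmod x)\<^sup>2 - 2 * (t - 1) * n * c + n\<^sup>2 * t * (cmod y)\<^sup>2"
  proof -
    have "Re (of_real (t - 1) * x * cnj (of_real n * cnj z * y)) = (t - 1) * n * c"
      by (simp add: c_def algebra_simps)
    then show ?thesis
      unfolding complex_norm_diff_power2 norm_mult norm_of_real power_mult_distrib
      by (simp add: t_def)
  qed
  ultimately have "(t - 1) * ((t - 1) * (cmod x)\<^sup>2 - 2 * n * c + n\<^sup>2 * (cmod y)\<^sup>2) \<le> 0"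
    unfolding power_mult_distrib power2_eq_square[of "t - 1"] by (simp add: algebra_simps)
  with t have "(t - 1) * (cmod x)\<^sup>2 - 2 * n * c + n\<^sup>2 * (cmod y)\<^sup>2 \<le> 0"
    by (simp add: mult_le_0_iff)
  moreover have "(cmod (z * x - n * y))\<^sup>2 = t * (cmod x)\<^sup>2 - 2 * n * c + n\<^sup>2 * (cmod y)\<^sup>2"
    by (simp add: complex_norm_diff_power2 norm_mult power_mult_distrib n_def t_def c_def
        algebra_simps)
  ultimately have "(cmod (z * x - n * y))\<^sup>2 \<le> (cmod x)\<^sup>2"
    unfolding left_diff_distrib mult_1 by linarith
  then show "(cmod (z * poly (pderiv p) z - degree p * poly p z))\<^sup>2
      \<le> (cmod (poly (pderiv p) z))\<^sup>2"
    by (simp add: x_def y_def n_def)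
qed simp

section \<open>The operator with a fixed degree parameter\<close>

text \<open>Decoupling \<open>n\<close> from the degree makes the operator linear in
  \<open>p\<close>. For \<open>a \<noteq> 0\<close> it is \<open>- a\<close> times the polar
  derivative with pole \<open>-1/a\<close>.\<close>

definition polar :: "nat \<Rightarrow> complex \<Rightarrow> complex poly \<Rightarrow> complex \<Rightarrow> complex" where
  "polar n a p z = (1 + a * z) * poly (pderiv p) z - of_nat n * a * poly p z"

lemma polar_add: "polar n a (p + q) z = polar n a p z + polar n a q z"
  by (simp add: polar_def pderiv_add algebra_simps)

lemma polar_diff: "polar n a (p - q) z = polar n a p z - polar n a q z"
  by (simp add: polar_def pderiv_diff algebra_simps)

lemma polar_smult: "polar n a (smult c p) z = c * polar n a p z"
  by (simp add: polar_def pderiv_smult algebra_simps)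

text \<open>The value is \<open>p' + a (z p' - n p)\<close>. By Laguerre's bound the second term
  cannot cancel the first when \<open>cmod a < 1\<close>, unless both vanish, and then
  \<open>p z = 0\<close>.\<close>

lemma polar_nonzero:
  assumes "degree p > 0" "\<And>w. cmod w > 1 \<Longrightarrow> poly p w \<noteq> 0" "1 < cmod z" "cmod a < 1"
  shows "polar (degree p) a p z \<noteq> 0"
proof
  define x u where "x = poly (pderiv p) z"
    and "u = z * poly (pderiv p) z - degree p * poly p z"
  assume "polar (degree p) a p z = 0"
  then have "x = - a * u"
    by (simp add: polar_def x_def u_def algebra_simps add_eq_0_iff2)
  then have "cmod x = cmod a * cmod u" by (simp add: norm_mult)
  moreover have "p \<noteq> 0" using assms by auto
  then have "cmod u \<le> cmod x"
    unfolding u_def x_def by (intro norm_polar_le_norm_deriv assms) auto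
  ultimately have "cmod u \<le> cmod a * cmod u" by simp
  then have "u = 0" using assms(4) by (simp add: mult_le_cancel_right1)
  with \<open>x = - a * u\<close> have "degree p * poly p z = 0" by (simp add: x_def u_def)
  with assms show False by auto
qed

definition dilate_comb :: "complex \<Rightarrow> real \<Rightarrow> complex poly \<Rightarrow> complex poly" where
  "dilate_comb c R p = dilate R p + smult c p"

lemma dilate_comb_diff: "dilate_comb c R (p - q) = dilate_comb c R p - dilate_comb c R q"
  by (simp add: dilate_comb_def dilate_def pcompose_diff smult_diff_right)

lemma dilate_comb_smult: "dilate_comb c R (smult k p) = smult k (dilate_comb c R p)"
  by (simp add: dilate_comb_def dilate_def pcompose_smult smult_add_right mult.commute)

lemma poly_dilate_comb: "poly (dilate_comb c R p) z = poly p (of_real R * z) + c * poly p z"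
  by (simp add: dilate_comb_def dilate_def poly_pcompose mult.commute)

lemma coeff_dilate: "coeff (dilate R p) k = of_real R ^ k * coeff p k"
  by (simp add: dilate_def coeff_pcompose_linear)

lemma coeff_dilate_comb: "coeff (dilate_comb c R p) k = (of_real R ^ k + c) * coeff p k"
  by (simp add: dilate_comb_def coeff_dilate algebra_simps)

lemma polar_dilate_comb:
  "polar n a (dilate_comb c R p) z =
    (1 + a * z) * of_real R * poly (pderiv p) (of_real R * z)
      - of_nat n * a * poly p (of_real R * z)
    + c * ((1 + a * z) * poly (pderiv p) z - of_nat n * a * poly p z)"
  unfolding dilate_comb_def polar_add polar_smult
  by (simp add: polar_def dilate_def pderiv_pcompose poly_pcompose pderiv_pCons
      mult.commute mult.left_commute)

section \<open>Zero-freeness and comparison outside the disc\<close>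

lemma polar_dilate_comb_nonzero:
  assumes "degree p = n" "n > 0" "\<And>w. cmod w > 1 \<Longrightarrow> poly p w \<noteq> 0"
    and "1 < cmod z" "cmod a < 1" "1 < R" "cmod c \<le> ((R + 1) / 2) ^ n"
  shows "polar n a (dilate_comb c R p) z \<noteq> 0"
proof -
  let ?F = "dilate_comb c R p"
  have "p \<noteq> 0" using assms by auto
  \<comment> \<open>Since \<open>(R + 1) / 2 < R\<close>, the leading coefficient
    \<open>R ^ n + c\<close> survives and the combination keeps degree exactly
    \<open>n\<close>.\<close>
  have "cmod c < R ^ n"
    using assms by (intro le_less_trans[OF assms(7)] power_strict_mono) auto
  then have "of_real R ^ n + c \<noteq> 0"
    using assms(6) by (auto simp: add_eq_0_iff2 norm_power dest: arg_cong[where f = cmod])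
  then have "coeff ?F n \<noteq> 0"
    using \<open>p \<noteq> 0\<close> assms(1) by (auto simp: coeff_dilate_comb)
  moreover have "degree ?F \<le> n"
    using assms(1) by (auto intro!: degree_le simp: coeff_dilate_comb coeff_eq_0)
  ultimately have deg: "degree ?F = n"
    by (metis le_degree le_antisym)
  have "poly ?F w \<noteq> 0" if w: "cmod w > 1" for w
  proof
    assume "poly ?F w = 0"
    then have "cmod (poly p (of_real R * w)) = cmod c * cmod (poly p w)"
      by (simp add: poly_dilate_comb add_eq_0_iff2 norm_mult)
    also have "\<dots> \<le> ((R + 1) / 2) ^ n * cmod (poly p w)"
      by (intro mult_right_mono assms) auto
    also have "\<dots> < cmod (poly p (of_real R * w))"
      using poly_norm_expand_gt[of p w R] assms w \<open>p \<noteq> 0\<close> by auto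
    finally show False by simp
  qed
  then show ?thesis
    using polar_nonzero[of ?F z a] assms deg by auto
qed

text \<open>The condition on the coefficients at \<open>n\<close> is the comparison at infinity: it
  gives \<open>h - k g\<close> full degree, as the zero-freeness lemma demands.\<close>

lemma polar_dilate_comb_mono_strict:
  fixes g h :: "complex poly"
  assumes "degree g = n" "n > 0" "\<And>w. cmod w > 1 \<Longrightarrow> poly g w \<noteq> 0"
    and h: "degree h \<le> n" "\<And>w. cmod w > 1 \<Longrightarrow> cmod (poly h w) \<le> cmod (poly g w)"
      "cmod (coeff h n) \<le> cmod (coeff g n)"
    and par: "1 < cmod z" "cmod a < 1" "1 < R" "cmod c \<le> ((R + 1) / 2) ^ n"
  shows "cmod (polar n a (dilate_comb c R h) z) \<le> cmod (polar n a (dilate_comb c R g) z)"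
proof (rule ccontr)
  let ?L = "\<lambda>p. polar n a (dilate_comb c R p) z"
  assume less: "\<not> cmod (?L h) \<le> cmod (?L g)"
  have nz: "?L g \<noteq> 0" using assms by (intro polar_dilate_comb_nonzero)
  define k where "k = ?L h / ?L g"
  have k: "cmod k > 1" using less nz by (simp add: k_def norm_divide)
  define q where "q = h - smult k g"
  \<comment> \<open>Serves twice: for the leading coefficients and for the values outside the
    disc.\<close>
  have scale: "v = 0" if "u = k * v" "cmod u \<le> cmod v" for u v
  proof (rule ccontr)
    assume "v \<noteq> 0"
    then have "1 * cmod v < cmod k * cmod v" using k by (intro mult_strict_right_mono) auto
    with that show False by (simp add: norm_mult)
  qed
  have "g \<noteq> 0" using assms by auto
  have "coeff q n \<noteq> 0"
    using scale[OF _ h(3)] \<open>g \<noteq> 0\<close> assms(1) by (auto simp: q_def)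
  moreover have "degree q \<le> n"
    using assms(1) h(1) by (auto simp: q_def intro!: degree_diff_le)
  ultimately have "degree q = n" by (metis le_degree le_antisym)
  moreover have "poly q w \<noteq> 0" if "cmod w > 1" for w
    using scale[OF _ h(2)] assms(3) that by (auto simp: q_def)
  ultimately have "?L q \<noteq> 0"
    using assms by (intro polar_dilate_comb_nonzero)
  moreover have "?L q = 0"
    using nz by (simp add: q_def dilate_comb_diff dilate_comb_smult polar_diff polar_smult k_def)
  ultimately show False by simp
qed

text \<open>At \<open>cmod a = 1\<close> the operator may annihilate \<open>g\<close>, and at \<open>R = 1\<close> so may the
  combination, hence the passage to the limit.\<close>

lemma polar_dilate_comb_mono:
  fixes g h :: "complex poly"
  assumes "degree g = n" "n > 0" "\<And>w. cmod w > 1 \<Longrightarrow> poly g w \<noteq> 0"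
    and h: "degree h \<le> n" "\<And>w. cmod w > 1 \<Longrightarrow> cmod (poly h w) \<le> cmod (poly g w)"
      "cmod (coeff h n) \<le> cmod (coeff g n)"
    and par: "1 \<le> cmod z" "cmod a \<le> 1" "1 \<le> R" "cmod c \<le> ((R + 1) / 2) ^ n"
  shows "cmod (polar n a (dilate_comb c R h) z) \<le> cmod (polar n a (dilate_comb c R g) z)"
proof -
  \<comment> \<open>For \<open>s > 0\<close> the scaling makes the constraints on \<open>a\<close>,
    \<open>R\<close> and \<open>z\<close> strict at once and only enlarges the bound allowed for
    \<open>c\<close>.\<close>
  define L where "L p s = cmod (polar n (a / of_real (1 + s)) (dilate_comb c (R * (1 + s)) p)
    (z * of_real (1 + s)))" for p and s :: real
  have "isCont (L p) 0" for p
    unfolding L_def polar_dilate_comb by (intro continuous_intros) auto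
  then have lim: "(L p \<longlongrightarrow> L p 0) (at_right 0)" for p
    by (meson continuous_at filterlim_at_split)
  have "\<forall>\<^sub>F s in at_right 0. L h s \<le> L g s"
    unfolding eventually_at_right_field
  proof (intro exI[of _ 1] conjI allI impI)
    fix s :: real assume s: "0 < s" "s < 1"
    have norm: "cmod (1 + complex_of_real s) = 1 + s"
      using s by (metis abs_of_pos add_pos_pos norm_of_real of_real_1 of_real_add zero_less_one)
    have "1 < x * (1 + s)" if "1 \<le> x" for x
    proof -
      have "0 < x * s" using that s by simp
      with that show ?thesis by (simp add: algebra_simps)
    qed
    then have "1 < cmod z * (1 + s)" "1 < R * (1 + s)"
      using par by auto
    moreover have "cmod a < 1 + s" using s par by simp
    moreover have "((R + 1) / 2) ^ n \<le> ((R * (1 + s) + 1) / 2) ^ n"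
      using s par by (intro power_mono) (auto simp: algebra_simps)
    ultimately show "L h s \<le> L g s"
      unfolding L_def using s par
      by (intro polar_dilate_comb_mono_strict assms) (auto simp: norm_mult norm_divide norm)
  qed simp
  then have "L h 0 \<le> L g 0"
    by (intro tendsto_le[OF _ lim lim]) auto
  then show ?thesis by (simp add: L_def)
qed

section \<open>The reciprocal polynomial\<close>

text \<open>This is \<open>z^n * cnj (p (1 / cnj z))\<close> with \<open>n = degree p\<close>, so
  its modulus agrees with that of \<open>p\<close> on the unit circle.\<close>

definition conj_reflect :: "complex poly \<Rightarrow> complex poly" where
  "conj_reflect p = map_poly cnj (reflect_poly p)"

lemma coeff_conj_reflect:
  "coeff (conj_reflect p) k = (if k \<le> degree p then cnj (coeff p (degree p - k)) else 0)"
  by (simp add: conj_reflect_def coeff_map_poly coeff_reflect_poly)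

lemma degree_conj_reflect_le: "degree (conj_reflect p) \<le> degree p"
  by (auto intro!: degree_le simp: coeff_conj_reflect)

lemma norm_poly_conj_reflect:
  "z \<noteq> 0 \<Longrightarrow> cmod (poly (conj_reflect p) z) = cmod z ^ degree p * cmod (poly p (inverse (cnj z)))"
  by (simp add: conj_reflect_def poly_reflect_poly_nz norm_mult norm_power)

text \<open>Each root has modulus at least 1, so the reflection identity bounds \<open>z - r\<close>
  by its reflected factor; multiply over the roots.\<close>

lemma norm_poly_le_conj_reflect:
  assumes "p \<noteq> 0" "\<And>w. cmod w < 1 \<Longrightarrow> poly p w \<noteq> 0" "1 \<le> cmod z"
  shows "cmod (poly p z) \<le> cmod (poly (conj_reflect p) z)"
proof -
  have z: "z \<noteq> 0" using assms(3) by auto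
  have "cmod (poly p z) \<le> cmod z ^ degree p * cmod (poly p (inverse (cnj z)))"
    using assms(1,2)
  proof (induction p rule: poly_linear_factor_induct)
    case (const c)
    then show ?case by simp
  next
    case (mult r q)
    have r: "1 \<le> cmod r" using mult.prems[of r]
      by (force simp: poly_linear_factor_mult simp del: mult_pCons_left)
    have q0: "poly q w \<noteq> 0" if "cmod w < 1" for w
      using mult.prems[OF that] by (auto simp del: mult_pCons_left)
    have "1 \<le> (cmod r)\<^sup>2" "1 \<le> (cmod z)\<^sup>2"
      using r assms by auto
    then have "(1 - (cmod r)\<^sup>2) * ((cmod z)\<^sup>2 - 1) \<le> 0" by (simp add: mult_le_0_iff)
    with norm_reflection_identity[of z r] have "(cmod (z - r))\<^sup>2 \<le> (cmod (1 - cnj z * r))\<^sup>2"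
      by linarith
    then have "cmod (z - r) \<le> cmod (1 - cnj z * r)"
      by (rule power2_le_imp_le) simp
    also have "1 - cnj z * r = cnj z * (inverse (cnj z) - r)"
      using z by (simp add: field_simps)
    finally have "cmod (z - r) \<le> cmod z * cmod (inverse (cnj z) - r)"
      by (simp add: norm_mult)
    from mult_mono[OF this mult.IH[OF q0]] show ?case
      unfolding degree_linear_factor_mult[OF mult.hyps] poly_linear_factor_mult norm_mult power_Suc
      by (simp add: mult_ac)
  qed
  with z show ?thesis by (simp add: norm_poly_conj_reflect)
qed

text \<open>By Vieta the quotient of the two coefficients is, up to sign, the product of the roots.
  This is the comparison at infinity between \<open>p\<close> and its reciprocal.\<close>

lemma norm_lead_coeff_le_norm_coeff_0:
  fixes p :: "complex poly"
  assumes "p \<noteq> 0" "\<And>w. cmod w < 1 \<Longrightarrow> poly p w \<noteq> 0"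
  shows "cmod (lead_coeff p) \<le> cmod (coeff p 0)"
  using assms
proof (induction p rule: poly_linear_factor_induct)
  case (const c)
  then show ?case by simp
next
  case (mult r q)
  have r: "1 \<le> cmod r" using mult.prems[of r]
      by (force simp: poly_linear_factor_mult simp del: mult_pCons_left)
  have q0: "poly q w \<noteq> 0" if "cmod w < 1" for w
    using mult.prems[OF that] by (auto simp del: mult_pCons_left)
  have "1 * cmod (lead_coeff q) \<le> cmod r * cmod (coeff q 0)"
    using r mult.IH[OF q0] by (intro mult_mono) auto
  then show ?case
    unfolding lead_coeff_mult by (simp add: norm_mult)
qed

lemma norm_polar_le_conj_reflect:
  assumes "degree p = n" "n > 0" "\<And>w. cmod w < 1 \<Longrightarrow> poly p w \<noteq> 0"
    and "1 \<le> cmod z" "cmod a \<le> 1" "1 \<le> R" "cmod c \<le> ((R + 1) / 2) ^ n"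
  shows "cmod (polar n a (dilate_comb c R p) z) \<le> cmod (polar n a (dilate_comb c R (conj_reflect p)) z)"
proof (rule polar_dilate_comb_mono)
  have "p \<noteq> 0" using assms by auto
  \<comment> \<open>A nonzero constant term keeps the reflection at full degree.\<close>
  have "coeff p 0 \<noteq> 0" using assms(3)[of 0] by (simp add: poly_0_coeff_0)
  then have "coeff (conj_reflect p) n \<noteq> 0" by (simp add: coeff_conj_reflect assms(1))
  then show "degree (conj_reflect p) = n"
    using degree_conj_reflect_le[of p] assms(1) by (metis le_degree le_antisym)
  show "poly (conj_reflect p) w \<noteq> 0" if w: "1 < cmod w" for w
  proof -
    have "w \<noteq> 0" using w by auto
    moreover have "cmod (inverse (cnj w)) < 1"
      using w by (simp add: norm_inverse inverse_less_1_iff)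
    ultimately have "cmod (poly (conj_reflect p) w) \<noteq> 0"
      using assms(3) by (simp add: norm_poly_conj_reflect)
    then show ?thesis by simp
  qed
  show "cmod (poly p w) \<le> cmod (poly (conj_reflect p) w)" if "1 < cmod w" for w
    using norm_poly_le_conj_reflect[OF \<open>p \<noteq> 0\<close> assms(3)] that by simp
  show "cmod (coeff p n) \<le> cmod (coeff (conj_reflect p) n)"
    using norm_lead_coeff_le_norm_coeff_0[OF \<open>p \<noteq> 0\<close> assms(3)] assms(1)
    by (simp add: coeff_conj_reflect)
qed (use assms in auto)

section \<open>Bounds through the maximum of the polynomial\<close>

text \<open>Outside the disc the reflection evaluates \<open>p\<close> inside it, so
  \<open>M z^n\<close> dominates; at infinity the relevant value is \<open>p 0\<close>.\<close>

lemma norm_polar_conj_reflect_le_monom: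
  assumes "degree p = n" "n > 0" "\<And>w. cmod w \<le> 1 \<Longrightarrow> cmod (poly p w) \<le> M" "0 < M"
    and "1 \<le> cmod z" "cmod a \<le> 1" "1 \<le> R" "cmod c \<le> ((R + 1) / 2) ^ n"
  shows "cmod (polar n a (dilate_comb c R (conj_reflect p)) z)
    \<le> M * cmod (polar n a (dilate_comb c R (monom 1 n)) z)"
proof -
  let ?g = "smult (complex_of_real M) (monom 1 n)"
  have "cmod (polar n a (dilate_comb c R (conj_reflect p)) z)
      \<le> cmod (polar n a (dilate_comb c R ?g) z)"
  proof (rule polar_dilate_comb_mono)
    show "degree ?g = n" using assms by (simp add: degree_monom_eq)
    show "poly ?g w \<noteq> 0" if "1 < cmod w" for w
      using that assms by (auto simp: poly_monom)
    show "degree (conj_reflect p) \<le> n" using degree_conj_reflect_le assms(1) by metis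
    show "cmod (poly (conj_reflect p) w) \<le> cmod (poly ?g w)" if w: "1 < cmod w" for w
    proof -
      have "w \<noteq> 0" using w by auto
      moreover have "cmod (inverse (cnj w)) \<le> 1"
        using w by (simp add: norm_inverse inverse_le_1_iff)
      ultimately show ?thesis
        using assms(1,4) mult_left_mono[OF assms(3), of "inverse (cnj w)" "cmod w ^ n"]
        by (simp add: norm_poly_conj_reflect poly_monom norm_mult norm_power mult_ac)
    qed
    show "cmod (coeff (conj_reflect p) n) \<le> cmod (coeff ?g n)"
      using assms(3)[of 0] assms(1,4) by (simp add: coeff_conj_reflect poly_0_coeff_0)
  qed (use assms in auto)
  with assms(4) show ?thesis by (simp add: dilate_comb_smult polar_smult norm_mult)
qed

text \<open>Rotating \<open>y\<close> by \<open>u\<close> gives it the direction \<open>v\<close> of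
  \<open>x\<close>. It supplies the translating constant below and the extremal \<open>a\<close> and
  \<open>z\<close>.\<close>

lemma obtain_aligned_phase:
  obtains u v where "cmod u = 1" "cmod v = 1" "x = of_real (cmod x) * v" "u * y = of_real (cmod y) * v"
proof -
  \<comment> \<open>The default 1 keeps \<open>u\<close> and \<open>v\<close> unimodular when
    \<open>x\<close> or \<open>y\<close> is 0, where the alignment is trivial.\<close>
  define v where "v = (if x = 0 then 1 else sgn x)"
  define u where "u = (if y = 0 then 1 else of_real (cmod y) * v / y)"
  have "cmod v = 1" by (simp add: v_def norm_sgn)
  moreover have "x = of_real (cmod x) * v" by (simp add: v_def sgn_eq)
  moreover have "cmod u = 1" using \<open>cmod v = 1\<close> by (simp add: u_def norm_mult norm_divide)
  moreover have "u * y = of_real (cmod y) * v" by (simp add: u_def)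
  ultimately show ?thesis using that by blast
qed

lemma polar_one: "polar n a (dilate_comb c R 1) z = - ((1 + c) * of_nat n * a)"
  by (simp add: polar_dilate_comb algebra_simps)

lemma dilate_comb_monom: "dilate_comb c R (monom 1 n) = smult (of_real R ^ n + c) (monom 1 n)"
  by (rule poly_eqI) (simp add: coeff_dilate_comb)

lemma polar_monom: "polar n a (monom 1 n) z = of_nat n * z ^ (n - 1)"
  by (cases n) (simp_all add: polar_def pderiv_monom poly_monom algebra_simps)

text \<open>Translating \<open>p\<close> by a constant of modulus \<open>m > M\<close> keeps it free of zeros in the disc; the
  phase of the constant is chosen so that the reflected side of the comparison becomes
  \<open>m * cmod ?B - cmod ?A\<close>.\<close>

lemma norm_polar_add_conj_reflect_le:
  assumes "degree p = n" "n > 0" "\<And>w. cmod w \<le> 1 \<Longrightarrow> cmod (poly p w) \<le> M" "M < m"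
    and "1 \<le> cmod z" "cmod a \<le> 1" "1 \<le> R" "cmod c \<le> ((R + 1) / 2) ^ n"
  shows "cmod (polar n a (dilate_comb c R p) z)
      + cmod (polar n a (dilate_comb c R (conj_reflect p)) z)
    \<le> m * (cmod (polar n a (dilate_comb c R (monom 1 n)) z)
        + cmod (polar n a (dilate_comb c R 1) z))"
    (is "cmod ?P + cmod ?A \<le> m * (cmod ?B + cmod ?C)")
proof -
  have "0 \<le> M" using order_trans[OF norm_ge_zero assms(3)[of 0]] by simp
  then have m: "0 < m" using assms(4) by simp
  \<comment> \<open>Fixes the sign of the aligned difference: its modulus is
    \<open>m * cmod ?B - cmod ?A\<close>.\<close>
  have le: "cmod ?A \<le> m * cmod ?B"
    using assms m by (intro norm_polar_conj_reflect_le_monom) force+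
  obtain u v where uv: "cmod u = 1" "cmod v = 1"
    "?A = of_real (cmod ?A) * v" "u * ?B = of_real (cmod ?B) * v"
    by (rule obtain_aligned_phase)
  \<comment> \<open>Reflection conjugates the constant, so \<open>cnj k = m u\<close> turns
    \<open>?B\<close> into the direction of \<open>?A\<close>.\<close>
  define k where "k = of_real m * cnj u"
  have k: "cmod k = m" using uv m by (simp add: k_def norm_mult)
  define q where "q = p - smult k 1"
  have deg: "degree q = n"
    unfolding q_def diff_conv_add_uminus using assms(1,2) by (subst degree_add_eq_left) auto
  have "poly q w \<noteq> 0" if "cmod w < 1" for w
    using assms(3)[of w] that k assms(4) by (auto simp: q_def)
  with assms deg have
    "cmod (polar n a (dilate_comb c R q) z) \<le> cmod (polar n a (dilate_comb c R (conj_reflect q)) z)"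
    by (intro norm_polar_le_conj_reflect) auto
  moreover have "polar n a (dilate_comb c R q) z = ?P - k * ?C"
    by (simp only: q_def dilate_comb_diff dilate_comb_smult polar_diff polar_smult)
  moreover have "conj_reflect q = conj_reflect p - smult (cnj k) (monom 1 n)"
  proof (rule poly_eqI)
    fix j
    have "coeff q i = coeff p i - (if i = 0 then k else 0)" for i
      by (simp add: q_def coeff_pCons split: nat.split)
    then show "coeff (conj_reflect q) j = coeff (conj_reflect p - smult (cnj k) (monom 1 n)) j"
      unfolding coeff_conj_reflect coeff_diff coeff_smult coeff_monom deg assms(1) by auto
  qed
  then have "polar n a (dilate_comb c R (conj_reflect q)) z = ?A - cnj k * ?B"
    by (simp only: dilate_comb_diff dilate_comb_smult polar_diff polar_smult)
  moreover have "cmod (?A - cnj k * ?B) = m * cmod ?B - cmod ?A"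
  proof -
    have "cnj k * ?B = of_real (m * cmod ?B) * v"
      using uv(4) by (simp add: k_def mult.assoc)
    then have "?A - cnj k * ?B = of_real (cmod ?A - m * cmod ?B) * v"
      using uv(3) by (metis left_diff_distrib of_real_diff)
    then have "cmod (?A - cnj k * ?B) = \<bar>cmod ?A - m * cmod ?B\<bar>"
      using uv(2) by (simp add: norm_mult del: of_real_diff)
    with le show ?thesis by simp
  qed
  moreover have "cmod ?P - m * cmod ?C \<le> cmod (?P - k * ?C)"
    using norm_triangle_ineq2[of ?P "k * ?C"] k by (simp add: norm_mult)
  ultimately show ?thesis by (simp add: algebra_simps)
qed

text \<open>The value at \<open>p\<close> is at most that at its reciprocal, hence at most half the
  bound on their sum.\<close>

lemma norm_polar_le:
  assumes "degree p = n" "\<And>w. cmod w < 1 \<Longrightarrow> poly p w \<noteq> 0"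
    and "\<And>w. cmod w \<le> 1 \<Longrightarrow> cmod (poly p w) \<le> M"
    and "1 \<le> cmod z" "cmod a \<le> 1" "1 \<le> R" "cmod c \<le> ((R + 1) / 2) ^ n"
  shows "cmod (polar n a (dilate_comb c R p) z)
    \<le> 1 / 2 * (cmod (of_real R ^ n + c) * cmod (polar n a (monom 1 n) z)
        + cmod (1 + c) * real n * cmod a) * M"
    (is "?l \<le> 1 / 2 * ?K * M")
proof (cases "n = 0")
  \<comment> \<open>In degree 0 both sides vanish; the comparison lemmas need
    \<open>n > 0\<close>.\<close>
  case True
  with assms(1) obtain d where "p = [:d:]" by (metis degree_eq_zeroE)
  with True show ?thesis
    unfolding polar_dilate_comb by (simp add: polar_def pderiv_pCons)
next
  case False
  have *: "2 * ?l \<le> m * ?K" if "M < m" for m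
    using norm_polar_add_conj_reflect_le[OF assms(1) _ assms(3) that assms(4-7)]
      norm_polar_le_conj_reflect[OF assms(1) _ assms(2) assms(4-7)] False
    by (simp add: dilate_comb_monom polar_smult polar_one norm_mult)
  \<comment> \<open>The translation needs \<open>m > M\<close>, so \<open>M\<close> is reached as a
    limit from above.\<close>
  have "((\<lambda>m. m * ?K) \<longlongrightarrow> M * ?K) (at_right M)"
    by (intro tendsto_intros)
  then have "2 * ?l \<le> M * ?K"
    by (rule tendsto_lowerbound) (auto simp: eventually_at_right_field intro!: * exI[of _ "M + 1"])
  then show ?thesis by (simp add: mult_ac)
qed

section \<open>Translation into the stated quantities\<close>

lemma norm_poly_le_max_unit_circle:
  assumes "cmod w \<le> 1"
  shows "cmod (poly P w) \<le> max_unit_circle P"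
proof (rule maximum_modulus_frontier[of "poly P" "cball 0 1"])
  show "cmod (poly P z) \<le> max_unit_circle P" if "z \<in> frontier (cball 0 1)" for z
    using that max_unit_circle_is_max[of P] by (auto simp: sphere_def)
qed (use assms in \<open>auto intro!: holomorphic_intros continuous_intros\<close>)

lemma max_unit_circle_monom_add_1: "max_unit_circle (monom 1 n + 1) = 2"
proof (rule antisym)
  obtain w where w: "cmod w = 1" "cmod (poly (monom 1 n + 1) w) = max_unit_circle (monom 1 n + 1)"
    using max_unit_circle_is_max by blast
  have "cmod (w ^ n + 1) \<le> 1 + 1"
    using w(1) by (intro norm_triangle_le) (simp add: norm_power)
  with w(2) show "max_unit_circle (monom 1 n + 1) \<le> 2" by (simp add: poly_monom)
  show "2 \<le> max_unit_circle (monom 1 n + 1)"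
    using norm_poly_le_max_unit_circle[of 1 "monom 1 n + 1"] by (simp add: poly_monom)
qed

text \<open>The coefficient \<open>c\<close> for which the left-hand side is the operator on
  \<open>P (R z) + c P z\<close>.\<close>

definition comb_coeff :: "nat \<Rightarrow> complex \<Rightarrow> complex \<Rightarrow> real \<Rightarrow> complex" where
  "comb_coeff n \<alpha> \<beta> R = \<beta> * of_real (beta_factor n \<alpha> R) - \<alpha>"

text \<open>Subtracting \<open>cmod \<alpha>\<close> in \<open>beta_factor\<close> is what makes the
  triangle inequality end at exactly the admissible bound for \<open>c\<close>.\<close>

lemma norm_comb_coeff_le:
  assumes "cmod \<alpha> \<le> 1" "cmod \<beta> \<le> 1" "R \<ge> 1"
  shows "cmod (comb_coeff n \<alpha> \<beta> R) \<le> ((R + 1) / 2) ^ n"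
proof -
  have "1 \<le> ((R + 1) / 2) ^ n" using assms by (intro one_le_power) simp
  with assms(1) have b: "0 \<le> beta_factor n \<alpha> R"
    unfolding beta_factor_def by linarith
  have "cmod (comb_coeff n \<alpha> \<beta> R) \<le> cmod \<beta> * beta_factor n \<alpha> R + cmod \<alpha>"
    unfolding comb_coeff_def using norm_triangle_ineq4 b by (metis abs_of_nonneg norm_mult norm_of_real)
  also have "\<dots> \<le> 1 * beta_factor n \<alpha> R + cmod \<alpha>"
    using assms b by (intro add_right_mono mult_right_mono)
  finally show ?thesis by (simp add: beta_factor_def)
qed

lemma smirnov_lhs_eq:
  assumes "R \<ge> 1"
  shows "smirnov_lhs a \<alpha> \<beta> R P z =
    cmod (polar (degree P) a (dilate_comb (comb_coeff (degree P) \<alpha> \<beta> R) R P) z)"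
proof -
  have "R \<noteq> 0" using assms by simp
  show ?thesis
    unfolding smirnov_lhs_def mod_smirnov_dilate[OF \<open>R \<noteq> 0\<close>] polar_dilate_comb
    unfolding comb_coeff_def mod_smirnov_def
    by (simp add: algebra_simps)
qed

lemma smirnov_rhs_eq:
  "smirnov_rhs a \<alpha> \<beta> R P z =
    1 / 2 * (cmod (of_real R ^ degree P + comb_coeff (degree P) \<alpha> \<beta> R)
        * cmod (polar (degree P) a (monom 1 (degree P)) z)
      + cmod (1 + comb_coeff (degree P) \<alpha> \<beta> R) * real (degree P) * cmod a) * max_unit_circle P"
  by (simp add: smirnov_rhs_def Let_def comb_coeff_def mod_smirnov_def polar_def degree_monom_eq
      algebra_simps)

section \<open>Equality for \<open>z^n + 1\<close>\<close>

lemma degree_monom_add_1: "degree (monom 1 n + 1 :: 'a :: {comm_semiring_1, semiring_char_0} poly) = n"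
proof (cases n)
  case 0
  then show ?thesis by (simp add: monom_0 one_pCons)
next
  case (Suc m)
  then show ?thesis by (simp add: degree_add_eq_left degree_monom_eq)
qed

text \<open>The maximum 2 cancels the factor 1/2, so equality means equality in the triangle
  inequality for the contributions of \<open>z^n\<close> and 1.\<close>

lemma smirnov_eq_iff_monom_add_1:
  fixes n :: nat and \<alpha> \<beta> :: complex and R :: real
  assumes "R \<ge> 1"
  defines "c \<equiv> comb_coeff n \<alpha> \<beta> R"
  shows "smirnov_lhs a \<alpha> \<beta> R (monom 1 n + 1) z = smirnov_rhs a \<alpha> \<beta> R (monom 1 n + 1) z
    \<longleftrightarrow> cmod ((of_real R ^ n + c) * (of_nat n * z ^ (n - 1)) + - ((1 + c) * of_nat n * a))
      = cmod ((of_real R ^ n + c) * (of_nat n * z ^ (n - 1))) + cmod (- ((1 + c) * of_nat n * a))"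
proof -
  have "dilate_comb c R (monom 1 n + 1) = dilate_comb c R (monom 1 n) + dilate_comb c R 1"
    by (simp add: dilate_comb_def dilate_def pcompose_add smult_add_right)
  moreover have half: "1 / 2 * k * 2 = k" for k :: real by simp
  ultimately show ?thesis
    unfolding smirnov_lhs_eq[OF assms(1)] smirnov_rhs_eq degree_monom_add_1
      max_unit_circle_monom_add_1 half
    by (simp add: c_def polar_add dilate_comb_monom polar_smult polar_monom polar_one norm_mult
        norm_power)
qed

lemma norm_add_aligned:
  assumes "cmod v = 1" "x = of_real (cmod x) * v" "y = of_real (cmod y) * v"
  shows "cmod (x + y) = cmod x + cmod y"
proof -
  have "x + y = of_real (cmod x + cmod y) * v"
    using assms by (metis distrib_right of_real_add)
  then show ?thesis using assms(1) by (simp add: norm_mult del: of_real_add)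
qed

text \<open>Equality requires two phases to agree, which can fail for given \<open>a\<close> and
  \<open>z\<close>. Sharpness is therefore obtained by rotating \<open>a\<close>, or by rotating
  \<open>z\<close> when \<open>n \<ge> 2\<close>.\<close>

theorem theorem2p3:
  fixes n :: nat and \<alpha> \<beta> :: complex and R :: real
  assumes "cmod \<alpha> \<le> 1" and "cmod \<beta> \<le> 1" and "R \<ge> 1"
  shows
    "(\<forall>P a z. degree P = n \<longrightarrow> (\<forall>w. cmod w < 1 \<longrightarrow> poly P w \<noteq> 0) \<longrightarrow>
        cmod a \<le> 1 \<longrightarrow> cmod z \<ge> 1 \<longrightarrow>
        smirnov_lhs a \<alpha> \<beta> R P z \<le> smirnov_rhs a \<alpha> \<beta> R P z)
     \<and> (\<forall>s z. 0 \<le> s \<longrightarrow> s \<le> 1 \<longrightarrow> cmod z \<ge> 1 \<longrightarrow>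
        (\<exists>a. cmod a = s \<and>
             smirnov_lhs a \<alpha> \<beta> R (monom 1 n + 1) z = smirnov_rhs a \<alpha> \<beta> R (monom 1 n + 1) z))
     \<and> (n \<ge> 2 \<longrightarrow> (\<forall>a r. cmod a \<le> 1 \<longrightarrow> r \<ge> 1 \<longrightarrow>
        (\<exists>z. cmod z = r \<and>
             smirnov_lhs a \<alpha> \<beta> R (monom 1 n + 1) z = smirnov_rhs a \<alpha> \<beta> R (monom 1 n + 1) z)))"
proof (intro conjI allI impI)
  fix P a z
  assume "degree P = n" "\<forall>w. cmod w < 1 \<longrightarrow> poly P w \<noteq> 0" "cmod a \<le> 1" "cmod z \<ge> 1"
  then show "smirnov_lhs a \<alpha> \<beta> R P z \<le> smirnov_rhs a \<alpha> \<beta> R P z"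
    unfolding smirnov_lhs_eq[OF assms(3)] smirnov_rhs_eq
    using norm_comb_coeff_le[OF assms] assms(3)
    by (intro norm_polar_le norm_poly_le_max_unit_circle) auto
next
  fix s :: real and z :: complex
  assume s: "0 \<le> s"
  define c where "c = comb_coeff n \<alpha> \<beta> R"
  \<comment> \<open>The contribution of 1 is linear in \<open>a\<close>, so replacing
    \<open>s\<close> by \<open>u * s\<close> rotates it by \<open>u\<close>.\<close>
  obtain u v where uv: "cmod u = 1" "cmod v = 1"
    "(of_real R ^ n + c) * (of_nat n * z ^ (n - 1))
      = of_real (cmod ((of_real R ^ n + c) * (of_nat n * z ^ (n - 1)))) * v"
    "u * - ((1 + c) * of_nat n * of_real s)
      = of_real (cmod (- ((1 + c) * of_nat n * of_real s))) * v"
    by (rule obtain_aligned_phase)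
  show "\<exists>a. cmod a = s \<and>
      smirnov_lhs a \<alpha> \<beta> R (monom 1 n + 1) z = smirnov_rhs a \<alpha> \<beta> R (monom 1 n + 1) z"
    unfolding smirnov_eq_iff_monom_add_1[OF assms(3)] c_def[symmetric]
  proof (intro exI[of _ "u * of_real s"] conjI norm_add_aligned[OF uv(2,3)])
    show "cmod (u * of_real s) = s" using uv(1) s by (simp add: norm_mult)
    have "- ((1 + c) * of_nat n * (u * of_real s)) = u * - ((1 + c) * of_nat n * of_real s)"
      by simp
    moreover have "cmod (u * y) = cmod y" for y by (simp add: norm_mult uv(1))
    ultimately show "- ((1 + c) * of_nat n * (u * of_real s))
        = of_real (cmod (- ((1 + c) * of_nat n * (u * of_real s)))) * v"
      using uv(4) by metis
  qed
next
  fix a :: complex and r :: real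
  assume n: "n \<ge> 2" and r: "r \<ge> 1"
  define c where "c = comb_coeff n \<alpha> \<beta> R"
  obtain u v where uv: "cmod u = 1" "cmod v = 1"
    "- ((1 + c) * of_nat n * a) = of_real (cmod (- ((1 + c) * of_nat n * a))) * v"
    "u * ((of_real R ^ n + c) * (of_nat n * of_real r ^ (n - 1)))
      = of_real (cmod ((of_real R ^ n + c) * (of_nat n * of_real r ^ (n - 1)))) * v"
    by (rule obtain_aligned_phase)
  \<comment> \<open>The contribution of \<open>z^n\<close> contains \<open>z ^ (n - 1)\<close>, so
    rotating \<open>r\<close> by a root \<open>w\<close> of \<open>u\<close> turns it by
    \<open>u\<close>; the root exists because \<open>n - 1 > 0\<close>.\<close>
  obtain w where w: "w ^ (n - 1) = u"
    using nth_root_exists[of "n - 1" u] n by auto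
  have "cmod w ^ (n - 1) = 1" using w uv(1) by (metis norm_power)
  then have "cmod w = 1"
    using power_eq_imp_eq_base[of "cmod w" "n - 1" 1] n by simp
  show "\<exists>z. cmod z = r \<and>
      smirnov_lhs a \<alpha> \<beta> R (monom 1 n + 1) z = smirnov_rhs a \<alpha> \<beta> R (monom 1 n + 1) z"
    unfolding smirnov_eq_iff_monom_add_1[OF assms(3)] c_def[symmetric]
  proof (intro exI[of _ "w * of_real r"] conjI norm_add_aligned[OF uv(2) _ uv(3)])
    show "cmod (w * of_real r) = r" using \<open>cmod w = 1\<close> r by (simp add: norm_mult)
    show "(of_real R ^ n + c) * (of_nat n * (w * of_real r) ^ (n - 1))
        = of_real (cmod ((of_real R ^ n + c) * (of_nat n * (w * of_real r) ^ (n - 1)))) * v"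
      using uv(1,4) w by (simp add: norm_mult power_mult_distrib mult_ac)
  qed
qed

end
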